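(* Let $r\ge 1$ be an integer. If $G$ is a connected graph such that for some positive integer $k$ the graph $D_k(G)$ is connected and $r$-regular, then $|G|\le 2r$. Consequently, the class ${\cal D}_r$ of all $r$-regular connected graphs $H$ for which there exist a connected graph $G$ and a positive integer $k$ with $H\cong D_k(G)$ is finite (up to isomorphism), i.e. $|{\cal D}_r|<\infty$.
   Context: Graphs are finite and simple, with nonempty vertex set; $|G|$ denotes the number of vertices of $G$. A set $S\subseteq V(G)$ is a dominating set of $G$ if every vertex in $V(G)\setminus S$ is adjacent to at least one vertex of $S$. For a positive integer $k$, the $k$-dominating graph $D_k(G)$ is the graph whose vertices are the dominating sets of $G$ of cardinality at most $k$, two of them being adjacent if and only if one is obtained from the other by adding or deleting a single vertex. $\cong$ denotes graph isomorphism. *)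

theory Defs
  imports "Graph_Theory.Graph_Theory"
begin

text \<open>
  A finite simple graph is a \<^locale>\<open>pair_graph\<close>: a finite, loop-free, symmetric digraph without
  parallel arcs, in which an edge $uv$ is the pair of arcs $(u,v)$, $(v,u)$. The library predicate
  \<^const>\<open>connected\<close> includes nonemptiness of the vertex set, and \<^const>\<open>with_proj\<close> is inserted
  as a coercion.
\<close>

definition dominating_set :: "'a pair_pre_digraph \<Rightarrow> 'a set \<Rightarrow> bool" where
  "dominating_set G S \<longleftrightarrow>
     S \<subseteq> pverts G \<and> (\<forall>v \<in> pverts G - S. \<exists>u \<in> S. u \<rightarrow>\<^bsub>with_proj G\<^esub> v)"

definition dominating_graph :: "nat \<Rightarrow> 'a pair_pre_digraph \<Rightarrow> 'a set pair_pre_digraph" where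
  "dominating_graph k G =
     (let V = {S. dominating_set G S \<and> card S \<le> k}
      in \<lparr> pverts = V,
           parcs = {(S, T). S \<in> V \<and> T \<in> V \<and>
             ((\<exists>v. v \<notin> S \<and> T = insert v S) \<or> (\<exists>v. v \<in> S \<and> T = S - {v}))} \<rparr>)"

text \<open>In a symmetric digraph the out-degree of a vertex is its degree as an undirected graph.\<close>

definition regular_graph :: "nat \<Rightarrow> 'a pair_pre_digraph \<Rightarrow> bool" where
  "regular_graph r G \<longleftrightarrow> (\<forall>v \<in> pverts G. out_degree G v = r)"

text \<open>
  The class $\mathcal{D}_r$, represented by graphs whose vertices are natural numbers. Lemma
  \<open>dominating_class_complete\<close> below shows that graphs over other vertex types contribute no further
  isomorphism types.
\<close>

definition dominating_class :: "nat \<Rightarrow> nat pair_pre_digraph set" where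
  "dominating_class r =
     {H. pair_graph H \<and> connected H \<and> regular_graph r H \<and>
         (\<exists>(G :: nat pair_pre_digraph) k. pair_graph G \<and> connected G \<and> 0 < k \<and>
            digraph_iso H (dominating_graph k G))}"

definition iso_rel :: "'a pair_pre_digraph set \<Rightarrow> 'a pair_pre_digraph rel" where
  "iso_rel C = {(H, H'). H \<in> C \<and> H' \<in> C \<and> digraph_iso H H'}"

lemma digraph_iso_pair_iff:
  "digraph_iso (with_proj G) (with_proj H) \<longleftrightarrow> pair_wf_digraph G \<and>
     (\<exists>f. inj_on f (pverts G) \<and> pverts H = f ` pverts G \<and> parcs H = map_prod f f ` parcs G)"
  (is "?L \<longleftrightarrow> ?R")
proof
  assume ?L
  then obtain h where h: "pre_digraph.digraph_isomorphism (with_proj G) h"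
    and H: "with_proj H = app_iso h (with_proj G)" by (auto simp: digraph_iso_def)
  have wf: "pair_wf_digraph G" and inj: "inj_on (iso_verts h) (pverts G)"
    using h by (auto simp: pre_digraph.digraph_isomorphism_def wf_digraph_wp_iff)
  have V: "pverts H = iso_verts h ` pverts G" and A: "parcs H = iso_arcs h ` parcs G"
    and t: "iso_tail h = fst" and hd: "iso_head h = snd"
    using H by (auto simp: with_proj_def app_iso_def)
  have "iso_arcs h a = map_prod (iso_verts h) (iso_verts h) a" if "a \<in> parcs G" for a
    using h that t hd by (auto simp: pre_digraph.digraph_isomorphism_def prod_eq_iff)
  then have "parcs H = map_prod (iso_verts h) (iso_verts h) ` parcs G" using A by simp
  with wf inj V show ?R by blast
next
  assume ?R
  then obtain f where wf: "pair_wf_digraph G" and inj: "inj_on f (pverts G)"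
    and V: "pverts H = f ` pverts G" and A: "parcs H = map_prod f f ` parcs G" by blast
  let ?h = "\<lparr> iso_verts = f, iso_arcs = map_prod f f, iso_head = snd, iso_tail = fst \<rparr>"
  have "parcs G \<subseteq> pverts G \<times> pverts G"
    using wf by (auto simp: pair_wf_digraph_def)
  then have "inj_on (map_prod f f) (parcs G)"
    using map_prod_inj_on[OF inj inj] inj_on_subset by blast
  then have "pre_digraph.digraph_isomorphism (with_proj G) ?h"
    using wf inj by (auto simp: pre_digraph.digraph_isomorphism_def wf_digraph_wp_iff)
  moreover have "with_proj H = app_iso ?h (with_proj G)"
    using V A by (simp add: with_proj_def app_iso_def)
  ultimately show ?L by (auto simp: digraph_iso_def)
qed

lemma digraph_iso_pair_refl: "pair_wf_digraph G \<Longrightarrow> digraph_iso (with_proj G) (with_proj G)"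
  unfolding digraph_iso_pair_iff by (auto intro!: exI[of _ id] simp: map_prod.id)

lemma pair_wf_digraph_iso:
  assumes "digraph_iso (with_proj G) (with_proj H)"
  shows "pair_wf_digraph H"
  using assms unfolding digraph_iso_pair_iff pair_wf_digraph_def by fastforce

lemma digraph_iso_pair_sym:
  assumes "digraph_iso (with_proj G) (with_proj H)"
  shows "digraph_iso (with_proj H) (with_proj G)"
proof -
  obtain f where wf: "pair_wf_digraph G" and inj: "inj_on f (pverts G)"
    and V: "pverts H = f ` pverts G" and A: "parcs H = map_prod f f ` parcs G"
    using assms by (auto simp: digraph_iso_pair_iff)
  let ?g = "the_inv_into (pverts G) f"
  have "inj_on ?g (pverts H)" using inj V by (simp add: inj_on_the_inv_into)
  moreover have "pverts G = ?g ` pverts H" using inj V by (simp add: the_inv_into_onto)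
  moreover have "map_prod ?g ?g (map_prod f f a) = a" if "a \<in> parcs G" for a
    using that wf inj by (cases a) (auto simp: pair_wf_digraph_def the_inv_into_f_f)
  then have "parcs G = map_prod ?g ?g ` parcs H" using A by (simp add: image_image)
  ultimately show ?thesis
    using pair_wf_digraph_iso[OF assms] unfolding digraph_iso_pair_iff by blast
qed

lemma digraph_iso_pair_trans:
  assumes "digraph_iso (with_proj G) (with_proj H)" "digraph_iso (with_proj H) (with_proj K)"
  shows "digraph_iso (with_proj G) (with_proj K)"
proof -
  obtain f g where wf: "pair_wf_digraph G" and f: "inj_on f (pverts G)" "pverts H = f ` pverts G"
      "parcs H = map_prod f f ` parcs G"
    and g: "inj_on g (pverts H)" "pverts K = g ` pverts H" "parcs K = map_prod g g ` parcs H"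
    using assms by (auto simp: digraph_iso_pair_iff)
  have "inj_on (g \<circ> f) (pverts G)" using f g by (auto intro: comp_inj_on)
  moreover have "parcs K = map_prod (g \<circ> f) (g \<circ> f) ` parcs G"
    using f g by (simp add: image_image map_prod_def case_prod_unfold)
  ultimately show ?thesis
    using wf f g unfolding digraph_iso_pair_iff
    by (intro conjI exI[of _ "g \<circ> f"]) (auto simp: image_comp)
qed

lemma equiv_iso_rel: "equiv (dominating_class r) (iso_rel (dominating_class r))"
proof (rule equivI)
  show "iso_rel (dominating_class r) \<subseteq> dominating_class r \<times> dominating_class r"
    by (auto simp: iso_rel_def)
  show "refl_on (dominating_class r) (iso_rel (dominating_class r))"
    by (auto simp: refl_on_def iso_rel_def dominating_class_def pair_graph_def pair_digraph_def
        pair_fin_digraph_def intro!: digraph_iso_pair_refl)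
  show "sym (iso_rel (dominating_class r))"
    by (auto simp: sym_def iso_rel_def intro: digraph_iso_pair_sym)
  show "trans (iso_rel (dominating_class r))"
    by (auto simp: trans_def iso_rel_def intro: digraph_iso_pair_trans)
qed

lemma pair_graph_iff:
  "pair_graph G \<longleftrightarrow> finite (pverts G) \<and> parcs G \<subseteq> pverts G \<times> pverts G \<and> irrefl (parcs G) \<and>
     sym (parcs G)"
proof
  assume "pair_graph G"
  then interpret pair_graph G .
  show "finite (pverts G) \<and> parcs G \<subseteq> pverts G \<times> pverts G \<and> irrefl (parcs G) \<and> sym (parcs G)"
    using pair_finite_verts arc_fst_in_verts arc_snd_in_verts pair_no_loops pair_sym_arcs
    by (force simp: irrefl_def symmetric_def)
next
  assume R: "finite (pverts G) \<and> parcs G \<subseteq> pverts G \<times> pverts G \<and> irrefl (parcs G) \<and> sym (parcs G)"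
  then have "finite (parcs G)" by (meson finite_SigmaI finite_subset)
  with R show "pair_graph G"
    by unfold_locales (auto simp: irrefl_def symmetric_def)
qed

lemma pair_graph_dominating_graph:
  assumes "pair_graph G"
  shows "pair_graph (dominating_graph k G)"
proof -
  have "finite (Pow (pverts G))" using assms by (simp add: pair_graph_iff)
  moreover have "pverts (dominating_graph k G) \<subseteq> Pow (pverts G)"
    by (auto simp: dominating_graph_def dominating_set_def)
  ultimately have "finite (pverts (dominating_graph k G))" by (rule finite_subset[rotated])
  then show ?thesis
    by (auto simp: pair_graph_iff dominating_graph_def irrefl_def sym_def)
qed

lemma connected_pair_graph:
  assumes "pair_graph G"
  shows "connected (with_proj G) \<longleftrightarrow>
    pverts G \<noteq> {} \<and> (\<forall>u \<in> pverts G. \<forall>v \<in> pverts G. (u, v) \<in> (parcs G)\<^sup>*)"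
proof -
  interpret pair_graph G by fact
  have "u \<rightarrow>\<^sup>*\<^bsub>with_proj (mk_symmetric (with_proj G))\<^esub> v \<longleftrightarrow>
      (u, v) \<in> (parcs G)\<^sup>* \<inter> (pverts G \<times> pverts G)" for u v
    using reachable_mk_symmetric_eq pair_sym_arcs reachable_conv by simp
  then show ?thesis
    by (auto simp: connected_def strongly_connected_def)
qed

lemma dominating_set_map:
  assumes wf: "parcs G \<subseteq> pverts G \<times> pverts G" and inj: "inj_on f (pverts G)"
    and H: "pverts H = f ` pverts G" "parcs H = map_prod f f ` parcs G" and S: "S \<subseteq> pverts G"
  shows "dominating_set H (f ` S) \<longleftrightarrow> dominating_set G S"
proof -
  have arc: "(f u, f v) \<in> parcs H \<longleftrightarrow> (u, v) \<in> parcs G" if "u \<in> pverts G" "v \<in> pverts G" for u v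
  proof
    assume "(f u, f v) \<in> parcs H"
    then obtain x y where xy: "(x, y) \<in> parcs G" "f u = f x" "f v = f y" using H by auto
    then have "x = u" "y = v" using wf that inj by (auto dest!: inj_onD[OF inj])
    with xy show "(u, v) \<in> parcs G" by simp
  qed (auto simp: H intro: rev_image_eqI)
  have mem: "f v \<in> f ` S \<longleftrightarrow> v \<in> S" if "v \<in> pverts G" for v
    using that S inj by (simp add: inj_on_image_mem_iff)
  have sub: "f ` S \<subseteq> pverts H" using S H by auto
  have diff: "pverts H - f ` S = f ` (pverts G - S)" using mem H by auto
  have "(\<forall>w \<in> pverts H - f ` S. \<exists>u \<in> f ` S. (u, w) \<in> parcs H) \<longleftrightarrow>
      (\<forall>v \<in> pverts G - S. \<exists>u \<in> S. (f u, f v) \<in> parcs H)"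
    unfolding diff by simp
  also have "\<dots> \<longleftrightarrow> (\<forall>v \<in> pverts G - S. \<exists>u \<in> S. (u, v) \<in> parcs G)"
    using arc S by (intro ball_cong bex_cong) auto
  finally show ?thesis using sub S by (simp add: dominating_set_def)
qed

lemma pair_graph_map:
  assumes G: "pair_graph G" and inj: "inj_on f (pverts G)"
    and H: "pverts H = f ` pverts G" "parcs H = map_prod f f ` parcs G"
  shows "pair_graph H" "connected (with_proj G) \<Longrightarrow> connected (with_proj H)"
    "regular_graph r G \<Longrightarrow> regular_graph r H"
    "digraph_iso (with_proj G) (with_proj H)"
    "digraph_iso (with_proj (dominating_graph k G)) (with_proj (dominating_graph k H))"
proof -
  have fin: "finite (pverts G)" and wf: "parcs G \<subseteq> pverts G \<times> pverts G"
    and irr: "irrefl (parcs G)" and sy: "sym (parcs G)" using G by (auto simp: pair_graph_iff)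
  have inj_arcs: "inj_on (map_prod f f) (parcs G)"
    using map_prod_inj_on[OF inj inj] wf inj_on_subset by blast
  have "f x \<noteq> f y" if "(x, y) \<in> parcs G" for x y
    using that inj irr wf by (auto simp: irrefl_def dest!: inj_onD[OF inj])
  then have "irrefl (parcs H)" using H by (auto simp: irrefl_def)
  moreover have "sym (parcs H)" using H sy by (force simp: sym_def)
  moreover have "finite (pverts H)" "parcs H \<subseteq> pverts H \<times> pverts H" using H fin wf by auto
  ultimately show pH: "pair_graph H" by (simp add: pair_graph_iff)
  have star: "(f u, f v) \<in> (parcs H)\<^sup>*" if "(u, v) \<in> (parcs G)\<^sup>*" for u v
    using that
  proof induction
    case (step y z)
    then have "(f y, f z) \<in> parcs H" using H by (auto intro: rev_image_eqI)
    with step.IH show ?case by (rule rtrancl_into_rtrancl)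
  qed simp
  show "connected (with_proj H)" if "connected (with_proj G)"
    using that star unfolding connected_pair_graph[OF G] connected_pair_graph[OF pH] H by auto
  show "regular_graph r H" if "regular_graph r G"
    unfolding regular_graph_def
  proof
    fix w assume "w \<in> pverts H"
    then obtain v where v: "v \<in> pverts G" "w = f v" using H by auto
    have "f x = f v \<longleftrightarrow> x = v" if "(x, y) \<in> parcs G" for x y
      using that v wf inj by (auto dest: inj_onD)
    then have "out_arcs (with_proj H) w = map_prod f f ` out_arcs (with_proj G) v"
      using H v by (force simp: out_arcs_def)
    moreover have "inj_on (map_prod f f) (out_arcs (with_proj G) v)"
      using inj_arcs by (rule inj_on_subset) (auto simp: out_arcs_def)
    ultimately have "out_degree (with_proj H) w = out_degree (with_proj G) v"
      by (simp add: out_degree_def card_image)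
    then show "out_degree (with_proj H) w = r"
      using \<open>regular_graph r G\<close> v by (simp add: regular_graph_def)
  qed
  have wfG: "pair_wf_digraph G" using wf by unfold_locales auto
  then show "digraph_iso (with_proj G) (with_proj H)"
    using inj H unfolding digraph_iso_pair_iff by blast
  let ?D = "dominating_graph k G" and ?E = "dominating_graph k H" and ?F = "(`) f"
  have D: "S \<subseteq> pverts G" if "S \<in> pverts ?D" for S
    using that by (simp add: dominating_graph_def dominating_set_def)
  have injF: "inj_on ?F (Pow (pverts G))" using inj by (rule inj_on_image_Pow)
  have "inj_on ?F (pverts ?D)" using injF by (rule inj_on_subset) (use D in auto)
  moreover have vert: "?F S \<in> pverts ?E \<longleftrightarrow> S \<in> pverts ?D" if "S \<subseteq> pverts G" for S
    using dominating_set_map[OF wf inj H that] card_image[OF inj_on_subset[OF inj that]]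
    by (simp add: dominating_graph_def)
  have surj: "\<exists>S. S \<subseteq> pverts G \<and> T = ?F S" if "T \<in> pverts ?E" for T
    using that H by (auto simp: dominating_graph_def dominating_set_def subset_image_iff)
  have V: "pverts ?E = ?F ` pverts ?D"
  proof (rule set_eqI)
    fix T
    show "T \<in> pverts ?E \<longleftrightarrow> T \<in> ?F ` pverts ?D"
    proof
      assume T: "T \<in> pverts ?E"
      then obtain S where S: "S \<subseteq> pverts G" "T = ?F S" using surj by metis
      then have "S \<in> pverts ?D" using vert T by simp
      with S show "T \<in> ?F ` pverts ?D" by simp
    next
      assume "T \<in> ?F ` pverts ?D"
      then obtain S where "S \<in> pverts ?D" "T = ?F S" by (rule imageE) simp
      then show "T \<in> pverts ?E" using vert D by simp
    qed
  qed
  have up: "(\<exists>w. w \<notin> ?F S \<and> ?F T = insert w (?F S)) \<longleftrightarrow> (\<exists>v. v \<notin> S \<and> T = insert v S)"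
    if S: "S \<subseteq> pverts G" and T: "T \<subseteq> pverts G" for S T
  proof
    assume "\<exists>w. w \<notin> ?F S \<and> ?F T = insert w (?F S)"
    then obtain w where w: "w \<notin> ?F S" "?F T = insert w (?F S)" by blast
    then obtain v where v: "v \<in> T" "w = f v" by blast
    then have "?F T = ?F (insert v S)" using w by simp
    then have "T = insert v S" using inj_on_image_eq_iff[OF inj T, of "insert v S"] S T v by auto
    then show "\<exists>v. v \<notin> S \<and> T = insert v S" using w v by blast
  next
    assume "\<exists>v. v \<notin> S \<and> T = insert v S"
    then obtain v where v: "v \<notin> S" "T = insert v S" by blast
    then have "f v \<notin> ?F S" using inj S T by (auto simp: inj_on_image_mem_iff)
    with v show "\<exists>w. w \<notin> ?F S \<and> ?F T = insert w (?F S)" by auto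
  qed
  have mem_arcs: "(A, B) \<in> parcs (dominating_graph k K) \<longleftrightarrow>
      A \<in> pverts (dominating_graph k K) \<and> B \<in> pverts (dominating_graph k K) \<and>
      ((\<exists>v. v \<notin> A \<and> B = insert v A) \<or> (\<exists>v. v \<notin> B \<and> A = insert v B))"
    for K :: "'c pair_pre_digraph" and A B
  proof -
    have "(\<exists>v. v \<in> A \<and> B = A - {v}) \<longleftrightarrow> (\<exists>v. v \<notin> B \<and> A = insert v B)"
      by blast
    then show ?thesis by (simp add: dominating_graph_def)
  qed
  have adj: "(?F S, ?F T) \<in> parcs ?E \<longleftrightarrow> (S, T) \<in> parcs ?D"
    if "S \<subseteq> pverts G" "T \<subseteq> pverts G" for S T
    by (simp only: mem_arcs vert[OF that(1)] vert[OF that(2)] up[OF that] up[OF that(2,1)])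
  have arcs_verts: "parcs (dominating_graph k K)
      \<subseteq> pverts (dominating_graph k K) \<times> pverts (dominating_graph k K)"
    for K :: "'c pair_pre_digraph" by (auto simp: dominating_graph_def Let_def)
  show "digraph_iso (with_proj ?D) (with_proj ?E)"
    unfolding digraph_iso_pair_iff
  proof (intro conjI exI[of _ ?F])
    show "pair_wf_digraph ?D" using arcs_verts[of G] by unfold_locales auto
    show "parcs ?E = map_prod ?F ?F ` parcs ?D"
    proof (rule set_eqI)
      fix e
      show "e \<in> parcs ?E \<longleftrightarrow> e \<in> map_prod ?F ?F ` parcs ?D"
      proof
        assume e: "e \<in> parcs ?E"
        obtain A B where AB: "e = (A, B)" by (cases e)
        then have "A \<in> pverts ?E" "B \<in> pverts ?E" using e mem_arcs by auto
        then obtain S T where ST: "S \<subseteq> pverts G" "A = ?F S" "T \<subseteq> pverts G" "B = ?F T"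
          using surj by metis
        then have "(S, T) \<in> parcs ?D" using adj e AB by simp
        then show "e \<in> map_prod ?F ?F ` parcs ?D" unfolding AB ST by (rule rev_image_eqI) simp
      next
        assume "e \<in> map_prod ?F ?F ` parcs ?D"
        then obtain a where a: "a \<in> parcs ?D" "e = map_prod ?F ?F a" by (rule imageE) simp
        obtain S T where ST: "a = (S, T)" by (cases a)
        have "S \<in> pverts ?D" "T \<in> pverts ?D" using a ST by (simp_all add: mem_arcs)
        then show "e \<in> parcs ?E" using adj[OF D D] a ST by simp
      qed
    qed
  qed fact+
qed

lemma nat_copy:
  assumes "pair_graph (G :: 'a pair_pre_digraph)"
  obtains f :: "'a \<Rightarrow> nat" where "inj_on f (pverts G)"
  using assms unfolding pair_graph_iff by (meson finite_imp_inj_to_nat_seg)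

lemma dominating_class_complete:
  fixes H :: "'b pair_pre_digraph" and G :: "'a pair_pre_digraph"
  assumes "pair_graph H" "connected H" "regular_graph r H" "pair_graph G" "connected G" "0 < k"
    and "digraph_iso H (dominating_graph k G)"
  shows "\<exists>H' \<in> dominating_class r. digraph_iso H H'"
proof -
  obtain f :: "'b \<Rightarrow> nat" where f: "inj_on f (pverts H)" using nat_copy assms(1) .
  obtain g :: "'a \<Rightarrow> nat" where g: "inj_on g (pverts G)" using nat_copy assms(4) .
  define H' where "H' = \<lparr> pverts = f ` pverts H, parcs = map_prod f f ` parcs H \<rparr>"
  define G' where "G' = \<lparr> pverts = g ` pverts G, parcs = map_prod g g ` parcs G \<rparr>"
  note H = pair_graph_map[OF assms(1) f, of H']
  note G = pair_graph_map[OF assms(4) g, of G']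
  have iso: "digraph_iso H H'" using H by (simp add: H'_def)
  have "digraph_iso (dominating_graph k G) (dominating_graph k G')" using G by (simp add: G'_def)
  then have "digraph_iso H' (dominating_graph k G')"
    using iso assms(7) digraph_iso_pair_sym digraph_iso_pair_trans by metis
  then have "H' \<in> dominating_class r"
    unfolding dominating_class_def using H G assms by (auto simp: H'_def G'_def)
  with iso show ?thesis by blast
qed

end

theory Submission
  imports Defs
begin

text \<open>
  Let $S$ be a dominating set of minimum cardinality $\gamma$. As $G$ has no isolated vertices, the
  complement of $S$ dominates as well, so $2\gamma \le |G|$. Since $r \ge 1$, the set $S$ has a
  neighbour in $D_k(G)$, which by minimality has $\gamma + 1$ elements; hence $\gamma < k$, and all
  $|G| - \gamma$ sets $S \cup \{v\}$ are neighbours of $S$, so that $|G|/2 \le |G| - \gamma \le r$.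
  Every graph in $\mathcal{D}_r$ then has at most $2^{2r}$ vertices.
\<close>

lemma dominating_set_mono:
  "dominating_set G S \<Longrightarrow> S \<subseteq> T \<Longrightarrow> T \<subseteq> pverts G \<Longrightarrow> dominating_set G T"
  unfolding dominating_set_def by blast

text \<open>If some \<open>v\<close> in \<open>S\<close> had all its neighbours inside
  \<open>S\<close>, it could be deleted: one of these neighbours dominates \<open>v\<close>, and no
  vertex outside \<open>S\<close> relies on \<open>v\<close>. So \<open>minimal\<close> gives every
  vertex of \<open>S\<close> a neighbour in the complement.\<close>

lemma dominating_set_complement:
  assumes G: "pair_graph G" and non_isolated: "\<And>v. v \<in> pverts G \<Longrightarrow> \<exists>u. (u, v) \<in> parcs G"
    and S: "dominating_set G S" and minimal: "\<And>v. v \<in> S \<Longrightarrow> \<not> dominating_set G (S - {v})"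
  shows "dominating_set G (pverts G - S)"
proof -
  have wf: "parcs G \<subseteq> pverts G \<times> pverts G" and irr: "irrefl (parcs G)" and sy: "sym (parcs G)"
    using G by (auto simp: pair_graph_iff)
  have "\<exists>u \<in> pverts G - S. (u, v) \<in> parcs G" if v: "v \<in> S" for v
  proof (rule ccontr)
    assume *: "\<not> ?thesis"
    have "v \<in> pverts G" using S v by (auto simp: dominating_set_def)
    then obtain w where w: "(w, v) \<in> parcs G" using non_isolated by blast
    then have "w \<in> S - {v}" using * wf irr by (auto simp: irrefl_def)
    moreover have "\<exists>u \<in> S - {v}. (u, x) \<in> parcs G" if x: "x \<in> pverts G - S" for x
    proof -
      obtain u where u: "u \<in> S" "(u, x) \<in> parcs G" using S x by (auto simp: dominating_set_def)
      \<comment> \<open>Otherwise, by symmetry, \<open>x\<close> would be a neighbour of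
        \<open>v\<close> outside \<open>S\<close>.\<close>
      then have "u \<noteq> v" using * x sy by (auto dest: symD)
      with u show ?thesis by blast
    qed
    ultimately have "dominating_set G (S - {v})"
      using S w by (fastforce simp: dominating_set_def)
    with minimal v show False by blast
  qed
  then show ?thesis using S by (auto simp: dominating_set_def)
qed

text \<open>The last arc on a path to \<open>v\<close> from some other vertex enters
  \<open>v\<close>; the bound on the cardinality provides that other vertex.\<close>

lemma connected_non_isolated:
  assumes G: "pair_graph G" and conn: "connected (with_proj G)" and card: "card (pverts G) \<ge> 2"
    and v: "v \<in> pverts G"
  shows "\<exists>u. (u, v) \<in> parcs G"
proof -
  have "\<not> pverts G \<subseteq> {v}" using card card_mono[of "{v}" "pverts G"] by auto
  then obtain w where w: "w \<in> pverts G" "w \<noteq> v" by blast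
  then have "(w, v) \<in> (parcs G)\<^sup>*" using conn v by (simp add: connected_pair_graph[OF G])
  with w(2) show ?thesis by (auto elim: rtranclE)
qed

lemma card_le_of_regular_dominating_graph:
  assumes r: "r \<ge> 1" and G: "pair_graph G" and conn: "connected (with_proj G)"
    and nonempty: "pverts (dominating_graph k G) \<noteq> {}"
    and reg: "regular_graph r (dominating_graph k G)"
  shows "card (pverts G) \<le> 2 * r"
\<comment> \<open>A one-vertex graph has an isolated vertex, so the complement argument fails there;
  the bound is then immediate from \<open>r \<ge> 1\<close>.\<close>
proof (cases "card (pverts G) \<ge> 2")
  case False
  with r show ?thesis by simp
next
  case True
  let ?D = "dominating_graph k G"
  have fin: "finite (pverts G)" using G by (simp add: pair_graph_iff)
  \<comment> \<open>The minimum is taken over all dominating sets of \<open>G\<close>, whatever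
    their size.\<close>
  obtain S where S: "dominating_set G S"
    and least: "\<And>T. dominating_set G T \<Longrightarrow> card S \<le> card T"
    using nonempty ex_has_least_nat[of "dominating_set G" _ card]
    by (auto simp: dominating_graph_def)
  have sub: "S \<subseteq> pverts G" using S by (simp add: dominating_set_def)
  have finS: "finite S" using sub fin by (rule finite_subset)
  \<comment> \<open>Some dominating set has at most \<open>k\<close> elements, hence so does the
    minimum one.\<close>
  have SD: "S \<in> pverts ?D"
    using nonempty S least by (force simp: dominating_graph_def)
  have minimal: "\<not> dominating_set G (S - {v})" if "v \<in> S" for v
    using least[of "S - {v}"] card_Diff1_less[OF finS that] by auto
  have "dominating_set G (pverts G - S)"
    using dominating_set_complement[OF G connected_non_isolated[OF G conn True] S minimal] .
  then have half: "2 * card S \<le> card (pverts G)"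
    using least card_Diff_subset[OF finS sub] card_mono[OF fin sub] by fastforce
  have deg: "card (out_arcs (with_proj ?D) S) = r"
    using reg SD by (simp add: regular_graph_def out_degree_def)
  with r have "out_arcs (with_proj ?D) S \<noteq> {}" by auto
  then obtain T where "(S, T) \<in> parcs ?D" by (auto simp: out_arcs_def)
  \<comment> \<open>A neighbour obtained by deleting a vertex would contradict
    \<open>minimal\<close>.\<close>
  then obtain v where "v \<notin> S" "T = insert v S" "card T \<le> k"
    using minimal by (auto simp: dominating_graph_def)
  then have less: "card S < k" using finS by simp
  have "(\<lambda>v. (S, insert v S)) ` (pverts G - S) \<subseteq> out_arcs (with_proj ?D) S"
  proof (rule image_subsetI)
    fix v assume v: "v \<in> pverts G - S"
    then have "dominating_set G (insert v S)"
      using dominating_set_mono[OF S, of "insert v S"] sub by auto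
    then have "insert v S \<in> pverts ?D" using less finS v by (simp add: dominating_graph_def)
    then show "(S, insert v S) \<in> out_arcs (with_proj ?D) S"
      using SD v by (auto simp: out_arcs_def dominating_graph_def)
  qed
  moreover have "inj_on (\<lambda>v. (S, insert v S)) (pverts G - S)" by (auto simp: inj_on_def)
  \<comment> \<open>An infinite set has \<open>card\<close> 0, whereas this one has
    \<open>card\<close> \<open>r \<ge> 1\<close>.\<close>
  moreover have "finite (out_arcs (with_proj ?D) S)"
    using deg r by (metis card.infinite not_one_le_zero)
  ultimately have "card (pverts G - S) \<le> r" using deg by (metis card_image card_mono)
  with half show ?thesis using card_Diff_subset[OF finS sub] by linarith
qed

lemma card_dominating_class:
  assumes r: "r \<ge> 1" and H: "H \<in> dominating_class r"
  shows "card (pverts H) \<le> 2 ^ (2 * r)"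
proof -
  obtain G :: "nat pair_pre_digraph" and k where G: "pair_graph G" "connected (with_proj G)"
    and iso: "digraph_iso (with_proj H) (with_proj (dominating_graph k G))"
    using H by (auto simp: dominating_class_def)
  let ?D = "dominating_graph k G"
  have pH: "pair_graph H" and conn: "connected (with_proj H)" and reg: "regular_graph r H"
    using H by (auto simp: dominating_class_def)
  obtain f where f: "inj_on f (pverts H)" "pverts ?D = f ` pverts H"
    "parcs ?D = map_prod f f ` parcs H"
    using iso by (auto simp: digraph_iso_pair_iff)
  have "pverts ?D \<noteq> {}" using conn f by (simp add: connected_pair_graph[OF pH])
  \<comment> \<open>Regularity is assumed of \<open>H\<close>; the isomorphism \<open>f\<close>
    carries it over to \<open>?D\<close>.\<close>
  then have "card (pverts G) \<le> 2 * r"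
    using card_le_of_regular_dominating_graph[OF r G] pair_graph_map(3)[OF pH f reg] by blast
  moreover have fin: "finite (pverts G)" using G by (simp add: pair_graph_iff)
  moreover have "pverts ?D \<subseteq> Pow (pverts G)"
    by (auto simp: dominating_graph_def dominating_set_def)
  ultimately have "card (pverts ?D) \<le> 2 ^ (2 * r)"
    using card_mono[of "Pow (pverts G)" "pverts ?D"]
    by (force simp: card_Pow intro: order_trans power_increasing)
  then show ?thesis using f by (simp add: card_image)
qed

text \<open>Allows a representative of an isomorphism class to be relabelled by any injection into
  the natural numbers.\<close>

lemma dominating_class_iso_closed:
  assumes "H \<in> dominating_class r" "inj_on f (pverts H)"
    and "pverts K = f ` pverts H" "parcs K = map_prod f f ` parcs H"
  shows "K \<in> dominating_class r" "(H, K) \<in> iso_rel (dominating_class r)"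
proof -
  have H: "pair_graph H" "connected (with_proj H)" "regular_graph r H"
    using assms(1) by (auto simp: dominating_class_def)
  note K = pair_graph_map[OF H(1) assms(2-4)]
  show "K \<in> dominating_class r"
    using assms(1) K(1) K(2)[OF H(2)] K(3)[OF H(3)]
      digraph_iso_pair_trans[OF digraph_iso_pair_sym[OF K(4)]]
    by (auto simp: dominating_class_def)
  then show "(H, K) \<in> iso_rel (dominating_class r)"
    using assms(1) K(4) by (simp add: iso_rel_def)
qed

lemma finite_graphs_on:
  assumes "finite A"
  shows "finite {K :: 'a pair_pre_digraph. pverts K \<subseteq> A \<and> parcs K \<subseteq> A \<times> A}"
proof (rule finite_subset)
  show "{K :: 'a pair_pre_digraph. pverts K \<subseteq> A \<and> parcs K \<subseteq> A \<times> A}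
      \<subseteq> (\<lambda>(V, E). \<lparr> pverts = V, parcs = E \<rparr>) ` (Pow A \<times> Pow (A \<times> A))"
  proof
    fix K :: "'a pair_pre_digraph"
    assume "K \<in> {K. pverts K \<subseteq> A \<and> parcs K \<subseteq> A \<times> A}"
    then show "K \<in> (\<lambda>(V, E). \<lparr> pverts = V, parcs = E \<rparr>) ` (Pow A \<times> Pow (A \<times> A))"
      by (intro image_eqI[of _ _ "(pverts K, parcs K)"]) simp_all
  qed
qed (use assms in simp)

lemma finite_dominating_class:
  assumes r: "r \<ge> 1"
  shows "finite (dominating_class r // iso_rel (dominating_class r))"
proof (rule finite_subset)
  \<comment> \<open>\<open>?A\<close> is a stock of labels large enough for every member of the
    class, depending only on \<open>r\<close>. Each class has a representative on these labels; a
    \<open>K\<close> in \<open>?F\<close> outside \<open>?C\<close> merely contributes the empty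
    set.\<close>
  let ?C = "dominating_class r" and ?A = "{..<2 ^ (2 * r)} :: nat set"
  let ?F = "{K :: nat pair_pre_digraph. pverts K \<subseteq> ?A \<and> parcs K \<subseteq> ?A \<times> ?A}"
  show "finite ((\<lambda>K. iso_rel ?C `` {K}) ` ?F)" by (intro finite_imageI finite_graphs_on) simp
  show "?C // iso_rel ?C \<subseteq> (\<lambda>K. iso_rel ?C `` {K}) ` ?F"
  proof
    fix X assume "X \<in> ?C // iso_rel ?C"
    then obtain H where H: "H \<in> ?C" "X = iso_rel ?C `` {H}" by (rule quotientE)
    then have fin: "finite (pverts H)" and wf: "parcs H \<subseteq> pverts H \<times> pverts H"
      by (auto simp: dominating_class_def pair_graph_iff)
    have "card (pverts H) \<le> card ?A" using card_dominating_class[OF r H(1)] by simp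
    then obtain f where f: "f ` pverts H \<subseteq> ?A" "inj_on f (pverts H)"
      using card_le_inj[OF fin] by blast
    define K where "K = \<lparr> pverts = f ` pverts H, parcs = map_prod f f ` parcs H \<rparr>"
    have "(H, K) \<in> iso_rel ?C"
      using dominating_class_iso_closed(2)[OF H(1) f(2)] by (simp add: K_def)
    then have "X = iso_rel ?C `` {K}" using H equiv_class_eq[OF equiv_iso_rel] by blast
    moreover have "K \<in> ?F" using f(1) wf by (force simp: K_def)
    ultimately show "X \<in> (\<lambda>K. iso_rel ?C `` {K}) ` ?F" by blast
  qed
qed

theorem theorem4p1:
  fixes r :: nat
  assumes "r \<ge> 1"
  shows "(\<forall>G :: 'a pair_pre_digraph.
            pair_graph G \<and> connected G \<and>
            (\<exists>k > 0. connected (dominating_graph k G) \<and> regular_graph r (dominating_graph k G))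
            \<longrightarrow> card (pverts G) \<le> 2 * r)
       \<and> finite (dominating_class r // iso_rel (dominating_class r))"
proof (intro conjI allI impI)
  fix G :: "'a pair_pre_digraph"
  assume "pair_graph G \<and> connected G \<and>
    (\<exists>k > 0. connected (dominating_graph k G) \<and> regular_graph r (dominating_graph k G))"
  then obtain k where G: "pair_graph G" "connected (with_proj G)"
    and D: "connected (with_proj (dominating_graph k G))" "regular_graph r (dominating_graph k G)"
    by blast
  \<comment> \<open>Connectedness includes having at least one vertex.\<close>
  have "pverts (dominating_graph k G) \<noteq> {}"
    using D(1) connected_pair_graph[OF pair_graph_dominating_graph[OF G(1)]] by blast
  with assms G D(2) show "card (pverts G) \<le> 2 * r"
    by (intro card_le_of_regular_dominating_graph)
qed (rule finite_dominating_class[OF assms])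

end
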